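(* \begin{enumerate} \item For all integers $d\ge 2$ and $b\ge a\ge d+1$, $\mathrm{ex}_b(a,b,S_{2,d*1})=\max\{da,\ d(a-1)+(b-a+1)\}$. \item For all integers $d\ge 1$ and $n\ge d+2$ we have $\mathrm{ex}_b(n,S_{3,d*1})=(d+1)n-c_{d,n}$ with some integer $c_{d,n}\ge 0$, where $c_{d,n}>0$ if and only if $n$ is not a multiple of $d+1$. \item For all integers $d\ge 2$ and $n\ge d+2$, $\mathrm{ex}_{b,c}(n,S_{3,d*1})=dn$. \end{enumerate}
   Context: All graphs are finite and simple. A graph is $F$-free if it has no (not necessarily induced) subgraph isomorphic to $F$. $\mathrm{ex}_b(a,b,F)$ is the largest number of edges of an $F$-free bipartite graph with parts of sizes $a$ and $b$, and $\mathrm{ex}_b(n,F)=\mathrm{ex}_b(n,n,F)$. $\mathrm{ex}_{b,c}(n,F)$ is the largest number of edges of an $F$-free connected bipartite graph with both parts of size $n$. For $k\ge 1$, $S_{k,d*1}$ is the tree on $k+d+1$ vertices obtained from one path with $k$ edges and $d$ paths with $1$ edge by identifying one endpoint of all these paths (so $S_{3,1*1}=P_5$, the path on 5 vertices). *)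

theory Defs
  imports Main
begin

type_synonym 'a graph = "'a set \<times> 'a set set"

abbreviation verts :: "'a graph \<Rightarrow> 'a set" where
  "verts G \<equiv> fst G"

abbreviation edges :: "'a graph \<Rightarrow> 'a set set" where
  "edges G \<equiv> snd G"

definition simple_graph :: "'a graph \<Rightarrow> bool" where
  "simple_graph G \<longleftrightarrow> finite (verts G) \<and> (\<forall>e \<in> edges G. e \<subseteq> verts G \<and> card e = 2)"

definition subgraph :: "'a graph \<Rightarrow> 'a graph \<Rightarrow> bool" where
  "subgraph H G \<longleftrightarrow> simple_graph H \<and> verts H \<subseteq> verts G \<and> edges H \<subseteq> edges G"

definition isomorphic :: "'a graph \<Rightarrow> 'b graph \<Rightarrow> bool" where
  "isomorphic G H \<longleftrightarrow>
    (\<exists>f. bij_betw f (verts G) (verts H) \<and> edges H = (\<lambda>e. f ` e) ` edges G)"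

definition free_of :: "'b graph \<Rightarrow> 'a graph \<Rightarrow> bool" where
  "free_of F G \<longleftrightarrow> \<not> (\<exists>H. subgraph H G \<and> isomorphic F H)"

definition bipartite_with_parts :: "'a graph \<Rightarrow> 'a set \<Rightarrow> 'a set \<Rightarrow> bool" where
  "bipartite_with_parts G A B \<longleftrightarrow> simple_graph G \<and> A \<union> B = verts G \<and> A \<inter> B = {} \<and>
    (\<forall>e \<in> edges G. \<exists>x \<in> A. \<exists>y \<in> B. e = {x, y})"

definition connected_graph :: "'a graph \<Rightarrow> bool" where
  "connected_graph G \<longleftrightarrow> verts G \<noteq> {} \<and>
    (\<forall>u \<in> verts G. \<forall>v \<in> verts G. (u, v) \<in> {(x, y). {x, y} \<in> edges G}\<^sup>*)"

text \<open>Every finite graph is isomorphic to one with vertices of type \<^typ>\<open>nat\<close>, so nothing is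
  lost by letting the host graphs range over that type.\<close>

definition ex_b_sizes :: "nat \<Rightarrow> nat \<Rightarrow> 'b graph \<Rightarrow> nat set" where
  "ex_b_sizes a b F = {card (edges G) | (G :: nat graph) A B.
     bipartite_with_parts G A B \<and> card A = a \<and> card B = b \<and> free_of F G}"

definition ex_b :: "nat \<Rightarrow> nat \<Rightarrow> 'b graph \<Rightarrow> nat" where
  "ex_b a b F = Max (ex_b_sizes a b F)"

definition ex_bc_sizes :: "nat \<Rightarrow> 'b graph \<Rightarrow> nat set" where
  "ex_bc_sizes n F = {card (edges G) | (G :: nat graph) A B.
     bipartite_with_parts G A B \<and> card A = n \<and> card B = n \<and> connected_graph G \<and> free_of F G}"

definition ex_bc :: "nat \<Rightarrow> 'b graph \<Rightarrow> nat" where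
  "ex_bc n F = Max (ex_bc_sizes n F)"

text \<open>The tree \<open>S\<^bsub>k,d*1\<^esub>\<close>: the centre is \<open>0\<close>, the path with \<open>k\<close> edges is \<open>0, 1, \<dots>, k\<close>, and the
  other endpoints of the \<open>d\<close> paths with one edge are \<open>k + 1, \<dots>, k + d\<close>.\<close>

definition spider :: "nat \<Rightarrow> nat \<Rightarrow> nat graph" where
  "spider k d = ({0..k + d}, {{i, Suc i} | i. i < k} \<union> {{0, j} | j. k < j \<and> j \<le> k + d})"

lemma simple_graph_spider: "simple_graph (spider k d)"
  by (auto simp: simple_graph_def spider_def card_insert_if)

text \<open>The sets whose maxima are taken are finite, so \<^const>\<open>Max\<close> is meaningful whenever they are
  nonempty.\<close>

lemma finite_ex_b_sizes: "finite (ex_b_sizes a b F)"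
proof (rule finite_subset)
  show "ex_b_sizes a b F \<subseteq> {..a * b}"
  proof
    fix m
    assume "m \<in> ex_b_sizes a b F"
    then obtain G :: "nat graph" and A B where
      m: "m = card (edges G)" and G: "bipartite_with_parts G A B" and
      sizes: "card A = a" "card B = b"
      unfolding ex_b_sizes_def by blast
    have fin: "finite A" "finite B"
      using G unfolding bipartite_with_parts_def simple_graph_def by (metis finite_Un)+
    have "edges G \<subseteq> (\<lambda>(x, y). {x, y}) ` (A \<times> B)"
      using G unfolding bipartite_with_parts_def by fast
    then have "card (edges G) \<le> card (A \<times> B)"
      using fin by (meson card_image_le card_mono finite_SigmaI finite_imageI le_trans)
    then show "m \<in> {..a * b}"
      by (simp add: m sizes card_cartesian_product)
  qed
qed simp

lemma finite_ex_bc_sizes: "finite (ex_bc_sizes n F)"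
  by (rule finite_subset[OF _ finite_ex_b_sizes[of n n F]])
    (auto simp: ex_bc_sizes_def ex_b_sizes_def)

end

theory Submission
  imports Defs
begin

text \<open>In a bipartite graph without the spider \<open>S\<^bsub>2,d*1\<^esub>\<close>, every component with a vertex of degree
  above \<open>d\<close> is a star. Without \<open>S\<^bsub>3,d*1\<^esub>\<close>, the component of a vertex of degree at least \<open>d + 2\<close>
  is a tree, and the component of a vertex \<open>v\<close> of degree \<open>d + 1\<close> meets the other part exactly in
  the neighbourhood of \<open>v\<close>. Counting edges componentwise, expressed as a local charging rule,
  gives the upper bounds, and equality \<open>(d + 1) n\<close> forces all components to be \<open>K\<^bsub>d+1,d+1\<^esub>\<close>.
  They are attained by circulant graphs, by a star together with a circulant graph, and by
  disjoint copies of \<open>K\<^bsub>d+1,d+1\<^esub>\<close>.\<close>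

section \<open>Neighbourhoods in simple graphs\<close>

definition nbrs :: "'a graph \<Rightarrow> 'a \<Rightarrow> 'a set" where
  "nbrs G x = {y. {x, y} \<in> edges G}"

lemma nbrs_sym: "y \<in> nbrs G x \<longleftrightarrow> x \<in> nbrs G y"
  by (simp add: nbrs_def insert_commute)

lemma nbrs_subset_verts: "simple_graph G \<Longrightarrow> nbrs G x \<subseteq> verts G"
  by (auto simp: nbrs_def simple_graph_def)

lemma finite_nbrs: "simple_graph G \<Longrightarrow> finite (nbrs G x)"
  using nbrs_subset_verts finite_subset unfolding simple_graph_def by metis

lemma nbrs_irrefl: "simple_graph G \<Longrightarrow> x \<notin> nbrs G x"
  by (auto simp: nbrs_def simple_graph_def)

subsection \<open>Spider-free graphs\<close>

lemma spider_embedding_not_free: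
  assumes G: "simple_graph G" and k: "k \<ge> 1" and inj: "inj_on f {0..k + d}"
    and path: "\<And>i. i < k \<Longrightarrow> f (Suc i) \<in> nbrs G (f i)"
    and leaf: "\<And>j. k < j \<Longrightarrow> j \<le> k + d \<Longrightarrow> f j \<in> nbrs G (f 0)"
  shows "\<not> free_of (spider k d) G"
proof -
  let ?V = "f ` {0..k + d}" and ?E = "(\<lambda>e. f ` e) ` edges (spider k d)"
  have sub: "?E \<subseteq> edges G"
    using path leaf by (auto simp: spider_def nbrs_def)
  \<comment> \<open>As \<open>k \<ge> 1\<close>, no vertex of the spider is isolated, so its image
    is an end of an edge of \<open>G\<close>.\<close>
  have "f i \<in> verts G" if "i \<le> k + d" for i
  proof -
    consider "i < k" | "i = k" | "k < i" by linarith
    then have "\<exists>x. f i \<in> nbrs G x"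
    proof cases
      case 1
      then show ?thesis using path nbrs_sym by metis
    next
      case 2
      then show ?thesis using path[of "k - 1"] k by auto
    next
      case 3
      then show ?thesis using leaf that by blast
    qed
    then show ?thesis using nbrs_subset_verts[OF G] by blast
  qed
  then have V: "?V \<subseteq> verts G" by auto
  have "e \<subseteq> ?V" if "e \<in> ?E" for e
    using that by (auto simp: spider_def)
  then have "subgraph (?V, ?E) G"
    using sub V G by (auto simp: subgraph_def simple_graph_def)
  moreover have "isomorphic (spider k d) (?V, ?E)"
    unfolding isomorphic_def using inj
    by (intro exI[of _ f]) (auto simp: spider_def bij_betw_def)
  ultimately show ?thesis by (auto simp: free_of_def)
qed

lemma not_free_spider_embedding:
  assumes "\<not> free_of (spider k d) G"
  obtains f where "inj_on f {0..k + d}"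
    and "\<And>i. i < k \<Longrightarrow> f (Suc i) \<in> nbrs G (f i)"
    and "\<And>j. k < j \<Longrightarrow> j \<le> k + d \<Longrightarrow> f j \<in> nbrs G (f 0)"
proof -
  obtain H f where H: "subgraph H G" and f: "bij_betw f {0..k + d} (verts H)"
    and E: "edges H = (\<lambda>e. f ` e) ` edges (spider k d)"
    using assms unfolding free_of_def isomorphic_def by (auto simp: spider_def)
  have E: "f ` e \<in> edges G" if "e \<in> edges (spider k d)" for e
    using that H E unfolding subgraph_def by auto
  show thesis
  proof (rule that)
    show "inj_on f {0..k + d}" using f by (simp add: bij_betw_def)
    show "f (Suc i) \<in> nbrs G (f i)" if "i < k" for i
      using E[of "{i, Suc i}"] that by (auto simp: spider_def nbrs_def)
    show "f j \<in> nbrs G (f 0)" if "k < j" "j \<le> k + d" for j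
      using E[of "{0, j}"] that by (auto simp: spider_def nbrs_def)
  qed
qed

text \<open>Once the path \<open>p\<close> is fixed, any \<open>d\<close> neighbours of its start
  that avoid the path can serve as leaves. Freeness thus becomes a matter of counting
  neighbours.\<close>

lemma free_of_spider_iff:
  assumes G: "simple_graph G" and k: "k \<ge> 1"
  shows "free_of (spider k d) G \<longleftrightarrow>
    (\<forall>p. inj_on p {..k} \<longrightarrow> (\<forall>i<k. p (Suc i) \<in> nbrs G (p i)) \<longrightarrow>
      card (nbrs G (p 0) - p ` {..k}) < d)"
proof (intro iffI allI impI)
  fix p
  assume free: "free_of (spider k d) G" and p: "inj_on p {..k}" "\<forall>i<k. p (Suc i) \<in> nbrs G (p i)"
  show "card (nbrs G (p 0) - p ` {..k}) < d"
  proof (rule ccontr)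
    assume "\<not> ?thesis"
    then obtain L where L: "L \<subseteq> nbrs G (p 0) - p ` {..k}" "card L = d" "finite L"
      using obtain_subset_with_card_n[of d "nbrs G (p 0) - p ` {..k}"] by auto
    have "card {k<..k + d} = card L" using L by simp
    then obtain g where g: "bij_betw g {k<..k + d} L"
      using L(3) finite_same_card_bij by blast
    define f where "f i = (if i \<le> k then p i else g i)" for i
    have "inj_on f ({..k} \<union> {k<..k + d})"
    proof (subst inj_on_Un, intro conjI)
      show "inj_on f {..k}" using p(1) by (auto simp: f_def inj_on_def)
      show "inj_on f {k<..k + d}"
        using bij_betw_imp_inj_on[OF g] by (auto simp: f_def inj_on_def)
      have "f ` {k<..k + d} = L"
        using bij_betw_imp_surj_on[OF g] by (auto simp: f_def image_iff)
      moreover have "f ` {..k} = p ` {..k}" by (auto simp: f_def)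
      ultimately show "f ` ({..k} - {k<..k + d}) \<inter> f ` ({k<..k + d} - {..k}) = {}"
        using L(1) by blast
    qed
    moreover have "{..k} \<union> {k<..k + d} = {0..k + d}" by auto
    ultimately have "inj_on f {0..k + d}" by simp
    moreover have "f (Suc i) \<in> nbrs G (f i)" if "i < k" for i
      using p(2) that by (auto simp: f_def)
    moreover have "f j \<in> nbrs G (f 0)" if "k < j" "j \<le> k + d" for j
      using bij_betwE[OF g] that L(1) by (auto simp: f_def)
    ultimately show False
      using spider_embedding_not_free[OF G k] free by blast
  qed
next
  assume *: "\<forall>p. inj_on p {..k} \<longrightarrow> (\<forall>i<k. p (Suc i) \<in> nbrs G (p i)) \<longrightarrow>
      card (nbrs G (p 0) - p ` {..k}) < d"
  show "free_of (spider k d) G"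
  proof (rule ccontr)
    assume "\<not> ?thesis"
    then obtain f where f: "inj_on f {0..k + d}"
      "\<And>i. i < k \<Longrightarrow> f (Suc i) \<in> nbrs G (f i)"
      "\<And>j. k < j \<Longrightarrow> j \<le> k + d \<Longrightarrow> f j \<in> nbrs G (f 0)"
      by (rule not_free_spider_embedding) blast
    have "f ` {k<..k + d} \<subseteq> nbrs G (f 0) - f ` {..k}"
      using f(3) inj_onD[OF f(1)] by fastforce
    then have "card (f ` {k<..k + d}) \<le> card (nbrs G (f 0) - f ` {..k})"
      by (intro card_mono) (auto simp: finite_nbrs G)
    moreover have "card (f ` {k<..k + d}) = d"
      using f(1) by (subst card_image) (auto simp: inj_on_def)
    moreover have "inj_on f {..k}" using f(1) by (auto simp: inj_on_def)
    ultimately show False using * f(2) by (metis leD)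
  qed
qed

text \<open>The path vertex \<open>p 1\<close> occupies one of the at most \<open>d\<close>
  neighbours of the centre.\<close>

lemma free_of_spider_if_degree_le:
  assumes G: "simple_graph G" and k: "k \<ge> 1" and deg: "\<And>x. card (nbrs G x) \<le> d"
  shows "free_of (spider k d) G"
  unfolding free_of_spider_iff[OF G k]
proof (intro allI impI)
  fix p
  assume p: "\<forall>i<k. p (Suc i) \<in> nbrs G (p i)"
  have "p 1 \<in> nbrs G (p 0)" "p 1 \<in> p ` {..k}" using p k by auto
  then have "nbrs G (p 0) - p ` {..k} \<subset> nbrs G (p 0)" by blast
  then show "card (nbrs G (p 0) - p ` {..k}) < d"
    using deg[of "p 0"] psubset_card_mono[OF finite_nbrs[OF G]] by (metis less_le_trans)
qed

subsection \<open>Bipartite graphs\<close>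

lemma bipartite_simple: "bipartite_with_parts G A B \<Longrightarrow> simple_graph G"
  by (simp add: bipartite_with_parts_def)

lemma bipartite_sym: "bipartite_with_parts G A B \<Longrightarrow> bipartite_with_parts G B A"
  unfolding bipartite_with_parts_def by (metis Int_commute Un_commute insert_commute)

lemma bipartite_finite:
  assumes "bipartite_with_parts G A B"
  shows "finite A" "finite B"
  using assms unfolding bipartite_with_parts_def simple_graph_def by (metis finite_Un)+

lemma bipartite_nbr_cases:
  assumes "bipartite_with_parts G A B" "y \<in> nbrs G x"
  shows "x \<in> A \<and> y \<in> B \<or> x \<in> B \<and> y \<in> A"
proof -
  obtain a b where "a \<in> A" "b \<in> B" "{x, y} = {a, b}"
    using assms unfolding bipartite_with_parts_def nbrs_def by fastforce
  then show ?thesis by (auto simp: doubleton_eq_iff)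
qed

lemma bipartite_nbrs_subset:
  assumes "bipartite_with_parts G A B" "x \<in> A"
  shows "nbrs G x \<subseteq> B"
  using bipartite_nbr_cases[OF assms(1)] assms unfolding bipartite_with_parts_def by blast

lemma bipartite_no_triangle:
  assumes "bipartite_with_parts G A B" "y \<in> nbrs G x" "z \<in> nbrs G y"
  shows "z \<notin> nbrs G x"
proof -
  have "A \<inter> B = {}" using assms(1) by (simp add: bipartite_with_parts_def)
  then show ?thesis
    using bipartite_nbr_cases[OF assms(1) assms(2)] bipartite_nbr_cases[OF assms(1) assms(3)]
      bipartite_nbr_cases[OF assms(1), of z x] by auto
qed

lemma bipartite_sum_swap:
  fixes h :: "'a \<Rightarrow> 'a \<Rightarrow> nat"
  assumes G: "bipartite_with_parts G A B"
  shows "(\<Sum>x\<in>A. \<Sum>y\<in>nbrs G x. h x y) = (\<Sum>y\<in>B. \<Sum>x\<in>nbrs G y. h x y)"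
proof -
  have A: "nbrs G x = {y \<in> B. y \<in> nbrs G x}" if "x \<in> A" for x
    using bipartite_nbrs_subset[OF G that] by blast
  have B: "nbrs G y = {x \<in> A. y \<in> nbrs G x}" if "y \<in> B" for y
    using bipartite_nbrs_subset[OF bipartite_sym[OF G] that] nbrs_sym by fast
  have "(\<Sum>x\<in>A. \<Sum>y\<in>nbrs G x. h x y) = (\<Sum>x\<in>A. \<Sum>y\<in>{y \<in> B. y \<in> nbrs G x}. h x y)"
    using A by (intro sum.cong) auto
  also have "\<dots> = (\<Sum>y\<in>B. \<Sum>x\<in>{x \<in> A. y \<in> nbrs G x}. h x y)"
    using bipartite_finite[OF G] by (rule sum.swap_restrict)
  also have "\<dots> = (\<Sum>y\<in>B. \<Sum>x\<in>nbrs G y. h x y)"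
    using B by (intro sum.cong) auto
  finally show ?thesis .
qed

lemma bipartite_card_edges:
  assumes G: "bipartite_with_parts G A B"
  shows "card (edges G) = (\<Sum>x\<in>A. card (nbrs G x))"
proof -
  have E: "edges G = (\<lambda>(x, y). {x, y}) ` (SIGMA x:A. nbrs G x)"
  proof (intro equalityI subsetI)
    fix e
    assume e: "e \<in> edges G"
    have "\<forall>e\<in>edges G. \<exists>x\<in>A. \<exists>y\<in>B. e = {x, y}"
      using G by (simp add: bipartite_with_parts_def)
    then obtain x y where "x \<in> A" "e = {x, y}" using e by blast
    then show "e \<in> (\<lambda>(x, y). {x, y}) ` (SIGMA x:A. nbrs G x)"
      using e by (auto simp: nbrs_def intro!: image_eqI[of _ _ "(x, y)"])
  qed (auto simp: nbrs_def)
  \<comment> \<open>Disjointness of the parts makes the orientation from \<open>A\<close> to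
    \<open>B\<close> unique.\<close>
  have "inj_on (\<lambda>(x, y). {x, y}) (SIGMA x:A. nbrs G x)"
  proof (rule inj_onI, clarify)
    fix x y x' y'
    assume *: "x \<in> A" "x' \<in> A" "y \<in> nbrs G x" "y' \<in> nbrs G x'" "{x, y} = {x', y'}"
    have "y \<in> B" "y' \<in> B" using * bipartite_nbrs_subset[OF G] by auto
    moreover have "A \<inter> B = {}" using G by (simp add: bipartite_with_parts_def)
    ultimately show "x = x' \<and> y = y'" using * by (auto simp: doubleton_eq_iff)
  qed
  then have "card (edges G) = card (SIGMA x:A. nbrs G x)"
    unfolding E by (rule card_image)
  then show ?thesis
    using bipartite_finite[OF G] finite_nbrs[OF bipartite_simple[OF G]] by simp
qed

text \<open>If the two ends of every edge together pay \<open>k\<close> for it, the total payment is \<open>k\<close> times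
  the number of edges.\<close>

lemma bipartite_charging:
  fixes f g :: "'a \<Rightarrow> 'a \<Rightarrow> nat"
  assumes G: "bipartite_with_parts G A B"
    and pay: "\<And>x y. x \<in> A \<Longrightarrow> y \<in> nbrs G x \<Longrightarrow> f x y + g y x = k"
  shows "k * card (edges G) =
    (\<Sum>x\<in>A. \<Sum>y\<in>nbrs G x. f x y) + (\<Sum>y\<in>B. \<Sum>x\<in>nbrs G y. g y x)"
proof -
  have "k * card (edges G) = (\<Sum>x\<in>A. \<Sum>y\<in>nbrs G x. k)"
    by (simp add: bipartite_card_edges[OF G] sum_distrib_left mult.commute)
  also have "\<dots> = (\<Sum>x\<in>A. \<Sum>y\<in>nbrs G x. f x y + g y x)"
    using pay by simp
  also have "\<dots> = (\<Sum>x\<in>A. \<Sum>y\<in>nbrs G x. f x y) + (\<Sum>x\<in>A. \<Sum>y\<in>nbrs G x. g y x)"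
    by (simp add: sum.distrib)
  also have "(\<Sum>x\<in>A. \<Sum>y\<in>nbrs G x. g y x) = (\<Sum>y\<in>B. \<Sum>x\<in>nbrs G y. g y x)"
    by (rule bipartite_sum_swap[OF G])
  finally show ?thesis .
qed

subsection \<open>Upper bounds\<close>

text \<open>By bipartiteness \<open>u\<close> is not adjacent to \<open>v\<close>, so the path
  \<open>v, w, u\<close> uses only the neighbour \<open>w\<close> of \<open>v\<close>, and fewer
  than \<open>d\<close> others may remain.\<close>

lemma spider2_free_degree_le:
  assumes G: "bipartite_with_parts G A B" and free: "free_of (spider 2 d) G"
    and w: "w \<in> nbrs G v" and u: "u \<in> nbrs G w" "u \<noteq> v"
  shows "card (nbrs G v) \<le> d"
proof -
  note sg = bipartite_simple[OF G]
  define p where "p i = [v, w, u] ! i" for i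
  have im: "p ` {..2} = {v, w, u}"
    by (auto simp: p_def numeral_2_eq_2 atMost_Suc)
  have ne: "v \<noteq> w" "w \<noteq> u" "u \<notin> nbrs G v" "v \<notin> nbrs G v"
    using w u nbrs_irrefl[OF sg] bipartite_no_triangle[OF G w u(1)] by auto
  have "inj_on p {..2}"
    using ne u(2) by (intro eq_card_imp_inj_on) (auto simp: im)
  moreover have "\<forall>i<2. p (Suc i) \<in> nbrs G (p i)"
    using w u by (auto simp: p_def less_2_cases_iff)
  ultimately have "card (nbrs G (p 0) - p ` {..2}) < d"
    using free free_of_spider_iff[OF sg, of 2 d] by auto
  moreover have "nbrs G (p 0) - p ` {..2} = nbrs G v - {w}"
    unfolding im using ne by (auto simp: p_def)
  ultimately show ?thesis
    using w finite_nbrs[OF sg] by (simp add: card_Diff_singleton_if)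
qed

text \<open>A vertex of degree above \<open>d\<close> is the centre of a star component, whose edges are paid by
  the leaves alone; any other edge is paid by its ends in the ratio \<open>d - 1\<close> to \<open>1\<close>.\<close>

lemma spider2_free_edges_le:
  assumes G: "bipartite_with_parts G A B" and free: "free_of (spider 2 d) G" and d: "d \<ge> 2"
    and v: "v \<in> A" "card (nbrs G v) > d"
  shows "card (edges G) \<le> (d - 1) * (card A - 1) + card B"
proof -
  let ?big = "\<lambda>x. card (nbrs G x) > d"
  define f where "f x y = (if ?big x then 0 else if ?big y then d else d - 1)" for x y
  define g where "g y x = (if ?big x then d else if ?big y then 0 else 1)" for x y
  have leaf: "nbrs G x = {y}" if "y \<in> nbrs G x" "?big y" for x y
    using spider2_free_degree_le[OF G free, of x y] that nbrs_sym by fastforce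
  have "d * card (edges G) =
      (\<Sum>x\<in>A. \<Sum>y\<in>nbrs G x. f x y) + (\<Sum>y\<in>B. \<Sum>x\<in>nbrs G y. g y x)"
    using d by (intro bipartite_charging[OF G]) (auto simp: f_def g_def)
  \<comment> \<open>The centre \<open>v\<close> pays nothing, which is where
    \<open>card A - 1\<close> comes from.\<close>
  also have "(\<Sum>x\<in>A. \<Sum>y\<in>nbrs G x. f x y) = (\<Sum>x\<in>A - {v}. \<Sum>y\<in>nbrs G x. f x y)"
    using v bipartite_finite[OF G] by (subst sum.remove[of A v]) (auto simp: f_def)
  also have "\<dots> \<le> (\<Sum>x\<in>A - {v}. d * (d - 1))"
  proof (rule sum_mono)
    fix x
    show "(\<Sum>y\<in>nbrs G x. f x y) \<le> d * (d - 1)"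
    proof (cases "?big x \<or> (\<exists>y\<in>nbrs G x. ?big y)")
      case True
      then show ?thesis
      proof
        \<comment> \<open>A leaf pays at most \<open>d\<close> for its only edge, and
          \<open>d \<le> d * (d - 1)\<close> because \<open>d \<ge> 2\<close>.\<close>
        assume "\<exists>y\<in>nbrs G x. ?big y"
        then obtain y where "nbrs G x = {y}" using leaf[of _ x] by blast
        then show ?thesis using d by (cases d) (auto simp: f_def)
      qed (simp add: f_def)
    next
      case False
      then have "(\<Sum>y\<in>nbrs G x. f x y) = card (nbrs G x) * (d - 1)"
        by (simp add: f_def)
      then show ?thesis using False by simp
    qed
  qed
  also have "(\<Sum>y\<in>B. \<Sum>x\<in>nbrs G y. g y x) \<le> (\<Sum>y\<in>B. d)"
  proof (rule sum_mono)
    fix y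
    show "(\<Sum>x\<in>nbrs G y. g y x) \<le> d"
    proof (cases "\<exists>x\<in>nbrs G y. ?big x")
      case True
      then obtain x where "nbrs G y = {x}" using leaf[of _ y] by blast
      then show ?thesis using True by (simp add: g_def)
    next
      case False
      then show ?thesis by (cases "?big y") (auto simp: g_def)
    qed
  qed
  finally have "d * card (edges G) \<le> d * ((d - 1) * (card A - 1) + card B)"
    using v by (simp add: algebra_simps)
  then show ?thesis using d by simp
qed

section \<open>Upper bounds for \<open>S_{3,d*1}\<close>\<close>

text \<open>On the path \<open>v, w, u, z\<close> the vertex \<open>u\<close> is never adjacent to
  \<open>v\<close>, whereas \<open>z\<close> may or may not be; removing \<open>w\<close> and
  \<open>z\<close> covers both cases.\<close>

lemma spider3_free_degree:
  assumes G: "bipartite_with_parts G A B" and free: "free_of (spider 3 d) G"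
    and w: "w \<in> nbrs G v" and u: "u \<in> nbrs G w" "u \<noteq> v" and z: "z \<in> nbrs G u" "z \<noteq> w"
  shows "card (nbrs G v - {w, z}) < d"
proof -
  note sg = bipartite_simple[OF G]
  define p where "p i = [v, w, u, z] ! i" for i
  have im: "p ` {..3} = {v, w, u, z}"
    by (auto simp: p_def numeral_3_eq_3 atMost_Suc)
  have ne: "v \<noteq> w" "w \<noteq> u" "u \<noteq> z" "u \<notin> nbrs G v" "v \<notin> nbrs G v"
    using w u z nbrs_irrefl[OF sg] bipartite_no_triangle[OF G w u(1)] by auto
  then have "v \<noteq> z" using z nbrs_sym by fast
  then have "inj_on p {..3}"
    using ne u(2) z(2) by (intro eq_card_imp_inj_on) (auto simp: im)
  moreover have "\<forall>i<3. p (Suc i) \<in> nbrs G (p i)"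
    using w u z by (auto simp: p_def numeral_3_eq_3 less_Suc_eq)
  ultimately have "card (nbrs G (p 0) - p ` {..3}) < d"
    using free free_of_spider_iff[OF sg, of 3 d] by auto
  moreover have "nbrs G (p 0) - p ` {..3} = nbrs G v - {w, z}"
    unfolding im using ne by (auto simp: p_def)
  ultimately show ?thesis by simp
qed

text \<open>With a second neighbour \<open>z\<close> of \<open>u\<close>, the path
  \<open>v, w, u, z\<close> would use at most two neighbours of \<open>v\<close> and leave
  \<open>d\<close> for the leaves.\<close>

lemma spider3_free_big:
  assumes G: "bipartite_with_parts G A B" and free: "free_of (spider 3 d) G"
    and big: "card (nbrs G v) \<ge> d + 2" and w: "w \<in> nbrs G v" and u: "u \<in> nbrs G w" "u \<noteq> v"
  shows "nbrs G u = {w}"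
proof -
  have "z = w" if "z \<in> nbrs G u" for z
  proof (rule ccontr)
    assume "z \<noteq> w"
    then have "card (nbrs G v - {w, z}) < d"
      by (rule spider3_free_degree[OF G free w u that])
    moreover have "card (nbrs G v) - card {w, z} \<le> card (nbrs G v - {w, z})"
      by (rule diff_card_le_card_Diff) simp
    moreover have "card {w, z} \<le> 2" by (simp add: card_insert_if)
    ultimately show False using big by linarith
  qed
  then show ?thesis using u nbrs_sym by fast
qed

text \<open>If \<open>z\<close> were outside \<open>nbrs G v\<close>, the path
  \<open>v, w, u, z\<close> would use only \<open>w\<close> and leave \<open>d\<close> neighbours of
  \<open>v\<close> for the leaves.\<close>

lemma spider3_free_full:
  assumes G: "bipartite_with_parts G A B" and free: "free_of (spider 3 d) G"
    and full: "card (nbrs G v) = d + 1" and w: "w \<in> nbrs G v" and u: "u \<in> nbrs G w"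
  shows "nbrs G u \<subseteq> nbrs G v"
proof (cases "u = v")
  case False
  show ?thesis
  proof
    fix z
    assume z: "z \<in> nbrs G u"
    show "z \<in> nbrs G v"
    proof (rule ccontr)
      assume z': "z \<notin> nbrs G v"
      then have "card (nbrs G v - {w, z}) < d"
        using w by (intro spider3_free_degree[OF G free w u False z]) auto
      moreover have "nbrs G v - {w, z} = nbrs G v - {w}" using z' by auto
      ultimately show False
        using w full finite_nbrs[OF bipartite_simple[OF G]] by (simp add: card_Diff_singleton_if)
    qed
  qed
qed simp

text \<open>The component of a vertex of degree at least \<open>d + 2\<close> is a tree of depth two. There, both
  ends of an edge between two such vertices pay half of it, and the remaining edges are paid by
  the end further away. All other edges are shared equally. The payments are in halves.\<close>

lemma spider3_free_charging:
  assumes G: "bipartite_with_parts G A B" and free: "free_of (spider 3 d) G" and d: "d \<ge> 1"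
  obtains s where "2 * card (edges G) = sum s A + sum s B"
    and "\<And>x. s x \<le> d + 1"
    and "\<And>x. card (nbrs G x) \<ge> d + 2 \<Longrightarrow> s x < d + 1"
    and "\<And>x. (\<And>y. card (nbrs G y) < d + 2) \<Longrightarrow> s x = card (nbrs G x)"
proof -
  note sg = bipartite_simple[OF G]
  note fin = finite_nbrs[OF sg]
  define big where "big x \<longleftrightarrow> card (nbrs G x) \<ge> d + 2" for x
  define near where "near x \<longleftrightarrow> (\<exists>y\<in>nbrs G x. big y)" for x
  \<comment> \<open>\<open>c x y\<close> is what \<open>x\<close> pays for its edge to
    \<open>y\<close>. A big vertex can itself be near another one, so bigness is tested
    first.\<close>
  define c :: "'a \<Rightarrow> 'a \<Rightarrow> nat" where
    "c x y = (if big x then if big y then 1 else 0 else if big y then 2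
      else if near x then 0 else if near y then 2 else 1)" for x y
  have leaf: "nbrs G u = {w}" if "big v" "w \<in> nbrs G v" "u \<in> nbrs G w" "u \<noteq> v" for u v w
    using spider3_free_big[OF G free] that unfolding big_def by blast
  \<comment> \<open>Here \<open>y\<close> is a leaf hanging from \<open>x\<close>, and its only
    neighbour \<open>x\<close> is not big.\<close>
  have not_near: "\<not> near y" if "near x" "y \<in> nbrs G x" "\<not> big x" "\<not> big y" for x y
    using that leaf[of _ x y] nbrs_sym[of _ G x] unfolding near_def by (metis singletonD)
  \<comment> \<open>Otherwise \<open>v'\<close> is at distance two from \<open>v\<close>, hence a
    leaf, contrary to its degree.\<close>
  have big_unique: "v = v'" if "v \<in> nbrs G x" "v' \<in> nbrs G x" "big v" "big v'" for x v v'
    using that leaf[of v x v'] nbrs_sym[of _ G x] d unfolding big_def by fastforce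
  define s where "s x = (\<Sum>y\<in>nbrs G x. c x y)" for x
  have near_sum: "s x = c x v" if "v \<in> nbrs G x" "big v" for x v
  proof -
    have "s x = c x v + (\<Sum>y\<in>nbrs G x - {v}. c x y)"
      unfolding s_def using that fin by (intro sum.remove)
    moreover have "c x y = 0" if "y \<in> nbrs G x - {v}" for y
    proof -
      have "near x" using \<open>v \<in> nbrs G x\<close> \<open>big v\<close> by (auto simp: near_def)
      moreover have "\<not> big y" using that big_unique[of v x y] \<open>v \<in> nbrs G x\<close> \<open>big v\<close> by auto
      ultimately show ?thesis by (simp add: c_def)
    qed
    ultimately show ?thesis by simp
  qed
  have big_sum: "s x \<le> 1" if "big x" for x
  proof (cases "near x")
    case True
    then show ?thesis using near_sum[of _ x] that by (auto simp: near_def c_def)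
  next
    case False
    then show ?thesis using that by (auto simp: near_def c_def s_def)
  qed
  have le: "s x \<le> d + 1" for x
  proof -
    \<comment> \<open>The kinds are: big vertices, their other neighbours, the leaves beyond these,
      and all the rest. The two middle kinds pay at most two halves, for one edge only;
      \<open>d \<ge> 1\<close> makes this at most \<open>d + 1\<close>.\<close>
    consider "big x" | "\<not> big x" "near x" | y where "\<not> big x" "\<not> near x" "y \<in> nbrs G x" "near y"
      | "\<not> big x" "\<not> near x" "\<forall>y\<in>nbrs G x. \<not> near y"
      by blast
    then show ?thesis
    proof cases
      case 1
      then show ?thesis using big_sum[of x] by simp
    next
      case 2
      then obtain v where "v \<in> nbrs G x" "big v" by (auto simp: near_def)
      then show ?thesis using near_sum[of v x] d by (auto simp: c_def)
    next
      case 3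
      then obtain v where "v \<in> nbrs G y" "big v" by (auto simp: near_def)
      then have "nbrs G x = {y}"
        using 3 leaf[of v y x] nbrs_sym[of _ G y] by blast
      then show ?thesis using d by (auto simp: s_def c_def)
    next
      case 4
      then have "s x = card (nbrs G x)" by (simp add: s_def c_def near_def)
      then show ?thesis using 4 by (simp add: big_def)
    qed
  qed
  show thesis
  proof (rule that)
    show "2 * card (edges G) = sum s A + sum s B"
      unfolding s_def[abs_def]
    proof (rule bipartite_charging[OF G])
      fix x y
      assume y: "y \<in> nbrs G x"
      then have x: "x \<in> nbrs G y" by (simp add: nbrs_sym)
      have "near x" if "big y" using y that by (auto simp: near_def)
      moreover have "near y" if "big x" using x that by (auto simp: near_def)
      ultimately show "c x y + c y x = 2" using not_near[OF _ y] by (auto simp: c_def)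
    qed
    show "s x \<le> d + 1" for x by (rule le)
    show "s x < d + 1" if "card (nbrs G x) \<ge> d + 2" for x
      using big_sum[of x] that d by (simp add: big_def)
    show "s x = card (nbrs G x)" if "\<And>y. card (nbrs G y) < d + 2" for x
    proof -
      have "\<not> big y" for y using that[of y] by (simp add: big_def)
      then show ?thesis by (simp add: s_def c_def near_def)
    qed
  qed
qed

text \<open>Equality forces every vertex to pay exactly \<open>d + 1\<close>, which a vertex of
  degree at least \<open>d + 2\<close> never does. So all degrees are \<open>d + 1\<close>, and the
  neighbourhoods of vertices in \<open>A\<close> partition \<open>B\<close> into classes of that
  size.\<close>

lemma spider3_free_edges_le:
  assumes G: "bipartite_with_parts G A B" and free: "free_of (spider 3 d) G" and d: "d \<ge> 1"
    and n: "card A = n" "card B = n"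
  shows "card (edges G) \<le> (d + 1) * n"
    and "card (edges G) = (d + 1) * n \<Longrightarrow> d + 1 dvd n"
proof -
  obtain s where s: "2 * card (edges G) = sum s A + sum s B"
    "\<And>x. s x \<le> d + 1"
    "\<And>x. card (nbrs G x) \<ge> d + 2 \<Longrightarrow> s x < d + 1"
    "\<And>x. (\<And>y. card (nbrs G y) < d + 2) \<Longrightarrow> s x = card (nbrs G x)"
    using spider3_free_charging[OF G free d] by blast
  have le: "sum s A \<le> (d + 1) * n" "sum s B \<le> (d + 1) * n"
    using sum_bounded_above[of A s "d + 1"] sum_bounded_above[of B s "d + 1"] s(2) n
    by (simp_all add: mult.commute)
  then show "card (edges G) \<le> (d + 1) * n" using s(1) by linarith
  assume "card (edges G) = (d + 1) * n"
  then have "sum s A = (d + 1) * n" "sum s B = (d + 1) * n" using le s(1) by linarith+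
  \<comment> \<open>As sums of constants, these equalities turn the bound on each \<open>s x\<close>
    into an equality.\<close>
  then have eqs: "sum s A = (\<Sum>x\<in>A. d + 1)" "sum s B = (\<Sum>x\<in>B. d + 1)"
    using n by simp_all
  have eq: "s x = d + 1" if "x \<in> A \<union> B" for x
    using that sum_mono_inv[OF eqs(1)] sum_mono_inv[OF eqs(2)] s(2) bipartite_finite[OF G]
    by blast
  have "card (nbrs G y) < d + 2" for y
  proof (cases "y \<in> A \<union> B")
    case True
    then show ?thesis using eq[of y] s(3)[of y] by linarith
  next
    case False
    then have "nbrs G y = {}" using bipartite_nbr_cases[OF G] by blast
    then show ?thesis by simp
  qed
  then have deg: "card (nbrs G x) = d + 1" if "x \<in> A \<union> B" for x
    using eq[OF that] s(4) by metis
  have "d + 1 dvd card (\<Union> (nbrs G ` A))"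
  proof (rule dvd_partition)
    show "finite (\<Union> (nbrs G ` A))"
      using bipartite_finite[OF G] finite_nbrs[OF bipartite_simple[OF G]] by simp
    show "\<forall>c\<in>nbrs G ` A. d + 1 dvd card c" using deg by auto
    \<comment> \<open>Through the common neighbour \<open>z\<close>,
      \<open>spider3_free_full\<close> applies from \<open>x\<close> and from \<open>y\<close>,
      giving both inclusions.\<close>
    have "nbrs G x = nbrs G y" if "x \<in> A" "y \<in> A" "z \<in> nbrs G x" "z \<in> nbrs G y" for x y z
      using spider3_free_full[OF G free, of x z y] spider3_free_full[OF G free, of y z x]
        deg that nbrs_sym by (metis UnI1 subset_antisym)
    then show "\<forall>c1\<in>nbrs G ` A. \<forall>c2\<in>nbrs G ` A. c1 \<noteq> c2 \<longrightarrow> c1 \<inter> c2 = {}" by blast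
  qed
  moreover have "\<Union> (nbrs G ` A) = B"
  proof
    show "\<Union> (nbrs G ` A) \<subseteq> B" using bipartite_nbrs_subset[OF G] by blast
    show "B \<subseteq> \<Union> (nbrs G ` A)"
    proof
      fix y
      assume y: "y \<in> B"
      then have "nbrs G y \<noteq> {}" using deg[of y] by auto
      then show "y \<in> \<Union> (nbrs G ` A)"
        using bipartite_nbrs_subset[OF bipartite_sym[OF G] y] nbrs_sym by fast
    qed
  qed
  ultimately show "d + 1 dvd n" using n by simp
qed

section \<open>Connected graphs\<close>

lemma connected_closed_superset:
  assumes "connected_graph G" "v \<in> verts G" "v \<in> S" "\<And>x. x \<in> S \<Longrightarrow> nbrs G x \<subseteq> S"
  shows "verts G \<subseteq> S"
proof
  fix u
  assume "u \<in> verts G"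
  then have "(v, u) \<in> {(x, y). {x, y} \<in> edges G}\<^sup>*"
    using assms unfolding connected_graph_def by blast
  then show "u \<in> S"
    by induction (use assms in \<open>auto simp: nbrs_def\<close>)
qed

text \<open>Let \<open>v\<close> in \<open>A\<close> have degree above \<open>d\<close>. Degree
  \<open>d + 1\<close> would confine \<open>B\<close> to \<open>nbrs G v\<close>, against
  \<open>n \<ge> d + 2\<close>. So the degree is at least \<open>d + 2\<close>, the graph is a tree
  of depth two rooted at \<open>v\<close>, and the other vertices of \<open>A\<close> are leaves: at
  most \<open>n + (n - 1)\<close> edges.\<close>

lemma spider3_free_connected_edges_le:
  assumes G: "bipartite_with_parts G A B" and free: "free_of (spider 3 d) G" and d: "d \<ge> 2"
    and con: "connected_graph G" and n: "card A = n" "card B = n" "n \<ge> d + 2"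
  shows "card (edges G) \<le> d * n"
proof (cases "\<forall>x\<in>A. card (nbrs G x) \<le> d")
  case True
  then show ?thesis
    using sum_bounded_above[of A "\<lambda>x. card (nbrs G x)" d] n
    by (simp add: bipartite_card_edges[OF G] mult.commute)
next
  case False
  then obtain v where v: "v \<in> A" "card (nbrs G v) > d" by force
  have V: "verts G = A \<union> B" and disj: "A \<inter> B = {}"
    using G unfolding bipartite_with_parts_def by auto
  note subB = bipartite_nbrs_subset[OF G]
  note subA = bipartite_nbrs_subset[OF bipartite_sym[OF G]]
  have big: "card (nbrs G v) \<ge> d + 2"
  proof (rule ccontr)
    assume "\<not> ?thesis"
    then have full: "card (nbrs G v) = d + 1" using v by simp
    have "verts G \<subseteq> nbrs G v \<union> {x \<in> A. nbrs G x \<subseteq> nbrs G v}"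
    proof (rule connected_closed_superset[OF con])
      fix x
      assume "x \<in> nbrs G v \<union> {x \<in> A. nbrs G x \<subseteq> nbrs G v}"
      then show "nbrs G x \<subseteq> nbrs G v \<union> {x \<in> A. nbrs G x \<subseteq> nbrs G v}"
        using spider3_free_full[OF G free full] subA subB[OF v(1)] by blast
    qed (use v V in auto)
    then have "B \<subseteq> nbrs G v" using V disj by blast
    then have "n \<le> d + 1"
      using full n card_mono[OF finite_nbrs[OF bipartite_simple[OF G]]] by metis
    then show False using n by simp
  qed
  have "verts G \<subseteq> insert v (nbrs G v \<union> {u. \<exists>w\<in>nbrs G v. nbrs G u = {w}})"
  proof (rule connected_closed_superset[OF con])
    fix x
    assume "x \<in> insert v (nbrs G v \<union> {u. \<exists>w\<in>nbrs G v. nbrs G u = {w}})"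
    then consider "x = v" | "x \<in> nbrs G v" | "\<exists>w\<in>nbrs G v. nbrs G x = {w}" by blast
    then show "nbrs G x \<subseteq> insert v (nbrs G v \<union> {u. \<exists>w\<in>nbrs G v. nbrs G u = {w}})"
    proof cases
      case 2
      then show ?thesis using spider3_free_big[OF G free big 2] by blast
    qed auto
  qed (use v V in auto)
  then have leaf: "card (nbrs G u) = 1" if "u \<in> A - {v}" for u
    using that V disj subB[OF v(1)] by fastforce
  have "card (edges G) = card (nbrs G v) + (\<Sum>u\<in>A - {v}. card (nbrs G u))"
    using v bipartite_finite[OF G] by (simp add: bipartite_card_edges[OF G] sum.remove)
  also have "(\<Sum>u\<in>A - {v}. card (nbrs G u)) = n - 1"
    using leaf v n by simp
  also have "card (nbrs G v) \<le> n"
    using card_mono[OF bipartite_finite(2)[OF G] subB[OF v(1)]] n by simp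
  finally have "card (edges G) \<le> 2 * n" by linarith
  also have "\<dots> \<le> d * n" using d by simp
  finally show ?thesis .
qed

subsection \<open>Constructions\<close>

text \<open>The right vertex \<open>j\<close> is stored as \<open>a + j\<close> to keep the parts
  disjoint within \<open>nat\<close>; degrees become sizes of images under \<open>R\<close> and its
  converse.\<close>

definition bip_graph :: "nat \<Rightarrow> nat \<Rightarrow> (nat \<times> nat) set \<Rightarrow> nat graph" where
  "bip_graph a b R = ({..<a + b}, (\<lambda>(i, j). {i, a + j}) ` R)"

lemma bip_graph_bipartite:
  assumes "R \<subseteq> {..<a} \<times> {..<b}"
  shows "bipartite_with_parts (bip_graph a b R) {..<a} {a..<a + b}"
proof -
  have "i < a \<and> j < b" if "(i, j) \<in> R" for i j using that assms by auto
  then show ?thesis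
    by (force simp: bipartite_with_parts_def simple_graph_def bip_graph_def card_insert_if)
qed

text \<open>For \<open>x \<ge> a + b\<close>, not a vertex, the index \<open>x - a\<close> is out of
  range and the formula correctly gives the empty set.\<close>

lemma nbrs_bip_graph:
  assumes R: "R \<subseteq> {..<a} \<times> {..<b}"
  shows "nbrs (bip_graph a b R) x =
    (if x < a then (+) a ` (R `` {x}) else (R\<inverse>) `` {x - a})"
proof -
  have "{x, y} \<in> edges (bip_graph a b R) \<longleftrightarrow>
      (\<exists>j. (x, j) \<in> R \<and> y = a + j) \<or> (\<exists>j. (y, j) \<in> R \<and> x = a + j)" for y
    by (auto simp: bip_graph_def doubleton_eq_iff image_iff Bex_def)
  then show ?thesis
    using R by (auto simp: nbrs_def)
qed

lemma card_edges_bip_graph: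
  assumes R: "R \<subseteq> {..<a} \<times> {..<b}"
  shows "card (edges (bip_graph a b R)) = card R"
proof -
  have "inj_on (\<lambda>(i, j). {i, a + j}) R"
    using R by (fastforce simp: inj_on_def doubleton_eq_iff)
  then show ?thesis by (simp add: bip_graph_def card_image)
qed

text \<open>The bipartite circulant graph, \<open>d\<close>-regular for
  \<open>d \<le> m\<close>.\<close>

definition circulant :: "nat \<Rightarrow> nat \<Rightarrow> (nat \<times> nat) set" where
  "circulant d m = {(i, (i + t) mod m) | i t. i < m \<and> t < d}"

lemma circulant_subset: "circulant d m \<subseteq> {..<m} \<times> {..<m}"
  by (auto simp: circulant_def)

lemma circulant_Image: "circulant d m `` {i} = (if i < m then (\<lambda>t. (i + t) mod m) ` {..<d} else {})"
  by (auto simp: circulant_def)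

lemma card_circulant_Image:
  assumes "d \<le> m" "i < m"
  shows "card (circulant d m `` {i}) = d"
proof -
  have "inj_on (\<lambda>t. (i + t) mod m) {..<d}"
  proof (rule inj_onI)
    fix s t
    assume "s \<in> {..<d}" "t \<in> {..<d}" "(i + s) mod m = (i + t) mod m"
    moreover then have "s mod m = t mod m"
      by (simp add: nat_mod_eq_iff add.assoc)
    ultimately show "s = t" using assms by simp
  qed
  then show ?thesis using assms by (simp add: circulant_Image card_image)
qed

lemma card_circulant_Image_le: "d \<le> m \<Longrightarrow> card (circulant d m `` {i}) \<le> d"
  using card_circulant_Image by (cases "i < m") (auto simp: circulant_Image)

lemma card_circulant_converse_le:
  assumes "d \<le> m"
  shows "card ((circulant d m)\<inverse> `` {j}) \<le> d"
proof -
  \<comment> \<open>The shift \<open>t\<close> and the target \<open>j\<close> determine the source;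
    \<open>t < d \<le> m\<close> keeps \<open>m - t\<close> from truncating.\<close>
  have "(circulant d m)\<inverse> `` {j} \<subseteq> (\<lambda>t. (j + (m - t)) mod m) ` {..<d}"
  proof
    fix i
    assume "i \<in> (circulant d m)\<inverse> `` {j}"
    then obtain t where t: "i < m" "t < d" "j = (i + t) mod m"
      by (auto simp: circulant_def)
    have "(j + (m - t)) mod m = (i + t + (m - t)) mod m"
      using t by (simp add: mod_add_left_eq)
    also have "\<dots> = i" using t assms by simp
    finally have "i = (j + (m - t)) mod m" by simp
    then show "i \<in> (\<lambda>t. (j + (m - t)) mod m) ` {..<d}" using t(2) by blast
  qed
  then show ?thesis by (metis card_lessThan finite_lessThan surj_card_le)
qed

lemma card_circulant: "d \<le> m \<Longrightarrow> card (circulant d m) = d * m"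
proof -
  assume d: "d \<le> m"
  have "circulant d m = (SIGMA i:{..<m}. circulant d m `` {i})"
    by (auto simp: circulant_def)
  then have "card (circulant d m) = card (SIGMA i:{..<m}. circulant d m `` {i})"
    by (rule arg_cong)
  also have "\<dots> = (\<Sum>i<m. card (circulant d m `` {i}))"
    by (rule card_SigmaI) (simp_all add: circulant_Image)
  also have "\<dots> = (\<Sum>i<m. d)" using d card_circulant_Image by simp
  finally show ?thesis by simp
qed

lemma circulant_degree_le:
  assumes "d \<le> m" "m \<le> a" "m \<le> b"
  shows "card (nbrs (bip_graph a b (circulant d m)) x) \<le> d"
proof -
  have "circulant d m \<subseteq> {..<a} \<times> {..<b}" using circulant_subset assms by fastforce
  then show ?thesis
    using card_circulant_Image_le[OF assms(1)] card_circulant_converse_le[OF assms(1)]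
    by (simp add: nbrs_bip_graph card_image)
qed

lemma ex_b_sizesI:
  assumes R: "R \<subseteq> {..<a} \<times> {..<b}" and free: "free_of F (bip_graph a b R)"
  shows "card R \<in> ex_b_sizes a b F"
proof -
  have "card {..<a} = a" "card {a..<a + b} = b" by auto
  then show ?thesis
    unfolding ex_b_sizes_def mem_Collect_eq
    using card_edges_bip_graph[OF R] bip_graph_bipartite[OF R] free by metis
qed

lemma circulant_ex_b_sizes:
  assumes "k \<ge> 1" "d \<le> m" "m \<le> a" "m \<le> b"
  shows "d * m \<in> ex_b_sizes a b (spider k d)"
proof -
  have R: "circulant d m \<subseteq> {..<a} \<times> {..<b}" using circulant_subset assms by fastforce
  have "free_of (spider k d) (bip_graph a b (circulant d m))"
    using assms bipartite_simple[OF bip_graph_bipartite[OF R]] circulant_degree_le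
    by (intro free_of_spider_if_degree_le) auto
  then show ?thesis using ex_b_sizesI[OF R] card_circulant[OF assms(2)] by simp
qed

text \<open>The graph is a circulant on the first \<open>a - 1\<close> vertices of each side plus a
  star from the last left vertex to the remaining right ones. No path with two edges starts at the
  centre of the star, and an edge from a star leaf uses up its only neighbour.\<close>

lemma star_circulant_ex_b_sizes:
  assumes d: "d \<ge> 1" "d + 1 \<le> a" "a \<le> b"
  shows "d * (a - 1) + (b - a + 1) \<in> ex_b_sizes a b (spider 2 d)"
proof -
  define m where "m = a - 1"
  have m: "a = Suc m" "d \<le> m" "m < b" using d by (auto simp: m_def)
  define R where "R = circulant d m \<union> {m} \<times> {m..<b}"
  have R: "R \<subseteq> {..<a} \<times> {..<b}" using circulant_subset m by (fastforce simp: R_def)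
  note sg = bipartite_simple[OF bip_graph_bipartite[OF R]]
  let ?G = "bip_graph a b R"
  have small: "card (nbrs ?G x) \<le> d \<or> x = m \<or> nbrs ?G x = {m}" for x
  proof (cases "x < a")
    case True
    then consider "x = m" | "x < m" using m by linarith
    then show ?thesis
    proof cases
      case 2
      then have "R `` {x} = circulant d m `` {x}" by (auto simp: R_def)
      then show ?thesis
        using True card_circulant_Image_le[OF m(2)] by (simp add: nbrs_bip_graph[OF R] card_image)
    qed simp
  next
    case False
    show ?thesis
    proof (cases "x - a < m")
      case True
      then have "R\<inverse> `` {x - a} = (circulant d m)\<inverse> `` {x - a}" by (auto simp: R_def)
      then show ?thesis
        using False card_circulant_converse_le[OF m(2)] by (simp add: nbrs_bip_graph[OF R])
    next
      case True: False
      then have "R\<inverse> `` {x - a} \<subseteq> {m}" using circulant_subset by (fastforce simp: R_def)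
      then have "nbrs ?G x = {m} \<or> nbrs ?G x = {}"
        using False by (auto simp: nbrs_bip_graph[OF R])
      then show ?thesis by auto
    qed
  qed
  have nbrs_m: "nbrs ?G w = {m}" if w: "w \<in> nbrs ?G m" for w
  proof -
    have "R `` {m} = {m..<b}" using circulant_subset by (fastforce simp: R_def)
    moreover have "m < a" using m by simp
    ultimately have "w \<in> (+) a ` {m..<b}" using w nbrs_bip_graph[OF R, of m] by simp
    then obtain j where "w = a + j" "m \<le> j" "j < b" by (rule imageE) simp
    moreover then have "R\<inverse> `` {j} = {m}" using circulant_subset by (fastforce simp: R_def)
    ultimately show ?thesis by (simp add: nbrs_bip_graph[OF R])
  qed
  have "free_of (spider 2 d) ?G"
  proof (subst free_of_spider_iff[OF sg], simp, intro allI impI)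
    fix p :: "nat \<Rightarrow> nat"
    assume inj: "inj_on p {..2}" and p: "\<forall>i<2. p (Suc i) \<in> nbrs ?G (p i)"
    have p01: "p 1 \<in> nbrs ?G (p 0)" and p12: "p 2 \<in> nbrs ?G (p 1)"
      using p by (auto simp: numeral_2_eq_2)
    have p1: "p 1 \<in> p ` {..2}" by simp
    have ne: "p 2 \<noteq> p 0" using inj_onD[OF inj, of 2 0] by auto
    have "p 0 \<noteq> m" using nbrs_m p01 p12 ne by auto
    then consider "card (nbrs ?G (p 0)) \<le> d" | "nbrs ?G (p 0) = {m}" using small by blast
    then show "card (nbrs ?G (p 0) - p ` {..2}) < d"
    proof cases
      case 1
      have "nbrs ?G (p 0) - p ` {..2} \<subset> nbrs ?G (p 0)" using p01 p1 by blast
      then show ?thesis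
        using 1 psubset_card_mono[OF finite_nbrs[OF sg]] by (metis less_le_trans)
    next
      case 2
      then have "nbrs ?G (p 0) - p ` {..2} = {}" using p01 p1 by auto
      then have "card (nbrs ?G (p 0) - p ` {..2}) = 0" by (simp only: card.empty)
      then show ?thesis using d(1) by linarith
    qed
  qed
  then have "card R \<in> ex_b_sizes a b (spider 2 d)" by (rule ex_b_sizesI[OF R])
  moreover have "card R = d * m + (b - m)"
    using card_circulant[OF m(2)] circulant_subset[of d m]
    unfolding R_def by (subst card_Un_disjoint) (auto intro: finite_subset)
  ultimately show ?thesis using m by (simp add: Suc_diff_Suc)
qed

text \<open>Joining indices with equal quotient by \<open>d + 1\<close> gives disjoint complete
  bipartite graphs. Vertices at distance two are twins, so \<open>p 1\<close> and \<open>p 3\<close>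
  are both neighbours of \<open>p 0\<close> and only \<open>d - 1\<close> remain.\<close>

lemma blocks_ex_b_sizes:
  assumes d: "d \<ge> 1" and n: "d + 1 dvd n"
  shows "(d + 1) * n \<in> ex_b_sizes n n (spider 3 d)"
proof -
  obtain q where q: "n = (d + 1) * q" using n by blast
  define block where "block i = {j. j div (d + 1) = i div (d + 1)}" for i
  have block: "block i = {(d + 1) * (i div (d + 1))..<(d + 1) * (i div (d + 1)) + (d + 1)}" for i
  proof -
    have "j div (d + 1) = k \<longleftrightarrow> (d + 1) * k \<le> j \<and> j < (d + 1) * k + (d + 1)" for j k
      using div_nat_eqI[of "d + 1" k j] times_div_less_eq_dividend[of "d + 1" j]
        dividend_less_times_div[of "d + 1" j] by auto
    then show ?thesis by (auto simp only: block_def atLeastLessThan_iff)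
  qed
  define R where "R = (SIGMA i:{..<n}. block i)"
  \<comment> \<open>As \<open>d + 1\<close> divides \<open>n\<close>, no block is cut off at
    \<open>n\<close>.\<close>
  have block_less: "j < n" if "j \<in> block i" "i < n" for i j
  proof -
    have "j div (d + 1) < q"
      using that q by (simp add: block_def div_less_iff_less_mult mult.commute)
    then show ?thesis using q by (simp add: div_less_iff_less_mult mult.commute)
  qed
  then have R: "R \<subseteq> {..<n} \<times> {..<n}" by (auto simp: R_def)
  note sg = bipartite_simple[OF bip_graph_bipartite[OF R]]
  let ?G = "bip_graph n n R"
  have left: "R `` {i} = (if i < n then block i else {})" for i by (auto simp: R_def)
  have right: "R\<inverse> `` {j} = (if j < n then block j else {})" for j
    using block_less by (auto simp: R_def) (auto simp: block_def)
  have N: "nbrs ?G x =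
      (if x < n then (+) n ` block x else if x - n < n then block (x - n) else {})" for x
    by (simp add: nbrs_bip_graph[OF R] left right)
  have block_cong: "block j = block i" if "j \<in> block i" for i j
    using that by (simp add: block_def)
  have fin: "finite (block i)" and card_block: "card (block i) = d + 1" for i
    by (simp_all add: block)
  have deg: "card (nbrs ?G x) \<le> d + 1" for x
    by (simp add: N card_image card_block)
  have twin: "nbrs ?G u = nbrs ?G v" if w: "w \<in> nbrs ?G v" and u: "u \<in> nbrs ?G w" for u v w
  proof (cases "v < n")
    case True
    then obtain j where j: "w = n + j" "j \<in> block v" "j < n"
      using w block_less by (auto simp: N)
    then have "u \<in> block v" using u block_cong by (simp add: N)
    then show ?thesis using True block_less block_cong by (simp add: N)
  next
    case False
    then have v: "v - n < n" "w \<in> block (v - n)" "w < n"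
      using w block_less by (auto simp: N split: if_splits)
    then obtain j where "u = n + j" "j \<in> block (v - n)" "j < n"
      using u block_cong block_less by (auto simp: N)
    then show ?thesis using False v block_cong by (simp add: N)
  qed
  have "free_of (spider 3 d) ?G"
  proof (subst free_of_spider_iff[OF sg], simp, intro allI impI)
    fix p :: "nat \<Rightarrow> nat"
    assume inj: "inj_on p {..3}" and p: "\<forall>i<3. p (Suc i) \<in> nbrs ?G (p i)"
    have "p 1 \<in> nbrs ?G (p 0)" "p 2 \<in> nbrs ?G (p 1)" "p 3 \<in> nbrs ?G (p 2)"
      using p by (auto simp: numeral_2_eq_2 numeral_3_eq_3)
    then have sub: "{p 1, p 3} \<subseteq> nbrs ?G (p 0)" using twin by blast
    have ne: "p 1 \<noteq> p 3" using inj_onD[OF inj, of 1 3] by auto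
    have "card (nbrs ?G (p 0) - p ` {..3}) \<le> card (nbrs ?G (p 0) - {p 1, p 3})"
      by (intro card_mono) (auto simp: finite_nbrs[OF sg])
    also have "\<dots> = card (nbrs ?G (p 0)) - 2"
      using sub ne by (subst card_Diff_subset) auto
    finally show "card (nbrs ?G (p 0) - p ` {..3}) < d"
      using deg[of "p 0"] d by linarith
  qed
  then have "card R \<in> ex_b_sizes n n (spider 3 d)" by (rule ex_b_sizesI[OF R])
  moreover have "card R = (d + 1) * n" using card_block fin by (simp add: R_def mult.commute)
  ultimately show ?thesis by simp
qed

text \<open>The shifts \<open>0\<close> and \<open>1\<close> already contain a zigzag path from left
  \<open>i\<close> through right \<open>i + 1\<close> to left \<open>i + 1\<close>.\<close>

lemma circulant_connected:
  assumes d: "2 \<le> d" and m: "0 < m"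
  shows "connected_graph (bip_graph m m (circulant d m))"
proof -
  let ?E = "{(x, y). {x, y} \<in> edges (bip_graph m m (circulant d m))}"
  have edge: "(i, m + (i + t) mod m) \<in> ?E" if "i < m" "t < 2" for i t
  proof -
    have "(i, (i + t) mod m) \<in> circulant d m" using that d by (auto simp: circulant_def)
    then show ?thesis by (force simp: bip_graph_def)
  qed
  have sym: "sym ?E" by (auto simp: sym_def insert_commute)
  have left: "(0, i) \<in> ?E\<^sup>*" if "i < m" for i
    using that
  proof (induction i)
    case (Suc i)
    have "(i, m + Suc i) \<in> ?E" using edge[of i 1] Suc.prems by simp
    moreover have "(m + Suc i, Suc i) \<in> ?E"
      using edge[of "Suc i" 0] Suc.prems sym by (simp add: insert_commute)
    ultimately show ?case using Suc by (meson Suc_lessD rtrancl.rtrancl_into_rtrancl)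
  qed simp
  have all: "(0, x) \<in> ?E\<^sup>*" if "x < m + m" for x
  proof (cases "x < m")
    case False
    then have "(x - m, x) \<in> ?E" using edge[of "x - m" 0] that by simp
    moreover have "(0, x - m) \<in> ?E\<^sup>*" using left that False by simp
    ultimately show ?thesis by (rule rtrancl.rtrancl_into_rtrancl[rotated])
  qed (rule left)
  have "(u, v) \<in> ?E\<^sup>*" if "u < m + m" "v < m + m" for u v
    using all[OF that(1)] all[OF that(2)] sym_rtrancl[OF sym] by (meson rtrancl_trans symD)
  then show ?thesis
    using m unfolding connected_graph_def by (simp add: bip_graph_def lessThan_empty_iff)
qed

lemma circulant_ex_bc_sizes:
  assumes "k \<ge> 1" "2 \<le> d" "d \<le> n"
  shows "d * n \<in> ex_bc_sizes n (spider k d)"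
proof -
  note R = circulant_subset[of d n]
  let ?G = "bip_graph n n (circulant d n)"
  have "free_of (spider k d) ?G"
    using assms bipartite_simple[OF bip_graph_bipartite[OF R]] circulant_degree_le
    by (intro free_of_spider_if_degree_le) auto
  moreover have "connected_graph ?G" using assms by (intro circulant_connected) auto
  moreover have "card (edges ?G) = d * n"
    using card_edges_bip_graph[OF R] card_circulant assms by simp
  moreover have "card {..<n} = n" "card {n..<n + n} = n" by auto
  ultimately show ?thesis
    unfolding ex_bc_sizes_def mem_Collect_eq using bip_graph_bipartite[OF R] by metis
qed

subsection \<open>The extremal numbers\<close>

lemma ex_b_spider2:
  assumes d: "d \<ge> 2" and a: "d + 1 \<le> a" "a \<le> b"
  shows "ex_b a b (spider 2 d) = max (d * a) (d * (a - 1) + (b - a + 1))"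
  unfolding ex_b_def
proof (rule Max_eqI[OF finite_ex_b_sizes])
  show "max (d * a) (d * (a - 1) + (b - a + 1)) \<in> ex_b_sizes a b (spider 2 d)"
    using circulant_ex_b_sizes[of 2 d a a b] star_circulant_ex_b_sizes[of d a b] assms
    by (simp add: max_def)
next
  fix e
  assume "e \<in> ex_b_sizes a b (spider 2 d)"
  then obtain G :: "nat graph" and A B where e: "e = card (edges G)"
    and G: "bipartite_with_parts G A B" and n: "card A = a" "card B = b"
    and free: "free_of (spider 2 d) G"
    unfolding ex_b_sizes_def by blast
  show "e \<le> max (d * a) (d * (a - 1) + (b - a + 1))"
  proof (cases "\<exists>v\<in>A. card (nbrs G v) > d")
    case True
    then have "e \<le> (d - 1) * (a - 1) + b"
      using spider2_free_edges_le[OF G free d] n e by blast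
    \<comment> \<open>The charging bound is the second term of the maximum; the assumptions make all
      subtractions exact.\<close>
    also have "(d - 1) * (a - 1) + b = d * (a - 1) + (b - a + 1)"
      using assms by (cases d; cases a) (auto simp: algebra_simps)
    finally show ?thesis by simp
  next
    case False
    then have "e \<le> d * a"
      using sum_bounded_above[of A "\<lambda>x. card (nbrs G x)" d] n e
      by (force simp: bipartite_card_edges[OF G] mult.commute)
    then show ?thesis by simp
  qed
qed

lemma ex_b_spider3:
  assumes d: "d \<ge> 1"
  shows "ex_b n n (spider 3 d) \<le> (d + 1) * n"
    and "ex_b n n (spider 3 d) = (d + 1) * n \<longleftrightarrow> d + 1 dvd n"
proof -
  let ?S = "ex_b_sizes n n (spider 3 d)"
  have bound: "e \<le> (d + 1) * n \<and> (e = (d + 1) * n \<longrightarrow> d + 1 dvd n)" if "e \<in> ?S" for e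
  proof -
    obtain G :: "nat graph" and A B where "e = card (edges G)" "bipartite_with_parts G A B"
      "card A = n" "card B = n" "free_of (spider 3 d) G"
      using \<open>e \<in> ?S\<close> unfolding ex_b_sizes_def by blast
    then show ?thesis using spider3_free_edges_le[of G A B d n] d by simp
  qed
  \<comment> \<open>The edgeless graph makes the set nonempty, so the maximum is attained and the
    equality criterion applies to it.\<close>
  have "free_of (spider 3 d) (bip_graph n n {})"
    using bipartite_simple[OF bip_graph_bipartite[of "{}" n n]]
    by (intro free_of_spider_if_degree_le) (auto simp: nbrs_bip_graph)
  then have "0 \<in> ?S" using ex_b_sizesI[of "{}" n n "spider 3 d"] by simp
  then have mem: "ex_b n n (spider 3 d) \<in> ?S"
    unfolding ex_b_def using Max_in[OF finite_ex_b_sizes] by blast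
  then show le: "ex_b n n (spider 3 d) \<le> (d + 1) * n" using bound by blast
  have "(d + 1) * n \<le> ex_b n n (spider 3 d)" if "d + 1 dvd n"
    unfolding ex_b_def by (rule Max_ge[OF finite_ex_b_sizes blocks_ex_b_sizes[OF d that]])
  then show "ex_b n n (spider 3 d) = (d + 1) * n \<longleftrightarrow> d + 1 dvd n"
    using le bound[OF mem] by (meson le_antisym)
qed

lemma ex_bc_spider3:
  assumes d: "d \<ge> 2" and n: "n \<ge> d + 2"
  shows "ex_bc n (spider 3 d) = d * n"
  unfolding ex_bc_def
proof (rule Max_eqI[OF finite_ex_bc_sizes])
  show "d * n \<in> ex_bc_sizes n (spider 3 d)"
    using assms by (intro circulant_ex_bc_sizes) auto
  show "e \<le> d * n" if "e \<in> ex_bc_sizes n (spider 3 d)" for e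
    using that spider3_free_connected_edges_le[OF _ _ d] n unfolding ex_bc_sizes_def by blast
qed

theorem theorem8:
  "(\<forall>d a b :: nat. d \<ge> 2 \<and> b \<ge> a \<and> a \<ge> d + 1 \<longrightarrow>
      ex_b a b (spider 2 d) = max (d * a) (d * (a - 1) + (b - a + 1))) \<and>
   (\<forall>d n :: nat. d \<ge> 1 \<and> n \<ge> d + 2 \<longrightarrow>
      (\<exists>c :: int. c \<ge> 0 \<and> int (ex_b n n (spider 3 d)) = (int d + 1) * int n - c \<and>
         (c > 0 \<longleftrightarrow> \<not> (d + 1) dvd n))) \<and>
   (\<forall>d n :: nat. d \<ge> 2 \<and> n \<ge> d + 2 \<longrightarrow> ex_bc n (spider 3 d) = d * n)"
proof (intro conjI allI impI)
  fix d n :: nat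
  assume "d \<ge> 1 \<and> n \<ge> d + 2"
  then have d: "d \<ge> 1" by simp
  \<comment> \<open>The deficit from the general upper bound, positive exactly when that bound is
    missed.\<close>
  define c where "c = int ((d + 1) * n) - int (ex_b n n (spider 3 d))"
  have "c \<ge> 0" "c > 0 \<longleftrightarrow> \<not> (d + 1) dvd n"
    using ex_b_spider3[OF d, of n] unfolding c_def by linarith+
  moreover have "int (ex_b n n (spider 3 d)) = (int d + 1) * int n - c"
    by (simp add: c_def algebra_simps)
  ultimately show "\<exists>c :: int. c \<ge> 0 \<and> int (ex_b n n (spider 3 d)) = (int d + 1) * int n - c \<and>
      (c > 0 \<longleftrightarrow> \<not> (d + 1) dvd n)"
    by blast
qed (use ex_b_spider2 ex_bc_spider3 in auto)

end
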